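(* Let $p$ be a prime and let $G$ be an abelian $p$-group such that $p^\omega G$ is bounded and $G/p^\omega G$ is Hopfian. Then $G$ is relatively Hopfian.
   Context: All groups are abelian, written additively. A group $G$ is Hopfian if every surjective endomorphism of $G$ is injective. $G$ is relatively Hopfian if, for every group $A$, the existence of a surjective homomorphism $G\to G\oplus A$ implies $A=\{0\}$. For a $p$-group $G$, $p^\omega G=\bigcap_{n<\omega}p^nG$. A group is bounded if it is annihilated by some positive integer. *)

theory Defs
  imports "HOL-Algebra.Algebra"
begin

text \<open>
  HOL-Algebra writes groups multiplicatively: \<open>x \<otimes>\<^bsub>G\<^esub> y\<close>, \<open>\<one>\<^bsub>G\<^esub>\<close> and \<open>x [^]\<^bsub>G\<^esub> n\<close>
  stand for \<open>x + y\<close>, \<open>0\<close> and \<open>n x\<close>. The direct sum of two groups is \<open>G \<times>\<times> A\<close>.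
  The predicates below are meant for groups satisfying \<open>comm_group\<close>.
\<close>

definition hopfian :: "('a, 'm) monoid_scheme \<Rightarrow> bool" where
  "hopfian G \<longleftrightarrow> (\<forall>f \<in> epi G G. inj_on f (carrier G))"

text \<open>
  HOL cannot quantify over types inside a formula, so the type of the elements of \<open>A\<close> is a
  parameter. "For every group \<open>A\<close>" is obtained by leaving \<open>'b\<close> arbitrary in a theorem
  concluding \<open>relatively_hopfian TYPE('b) G\<close>.
\<close>

definition relatively_hopfian :: "'b itself \<Rightarrow> ('a, 'm) monoid_scheme \<Rightarrow> bool" where
  "relatively_hopfian _ G \<longleftrightarrow>
     (\<forall>A :: 'b monoid. comm_group A \<longrightarrow> epi G (G \<times>\<times> A) \<noteq> {} \<longrightarrow> trivial_group A)"

definition p_primary :: "nat \<Rightarrow> ('a, 'm) monoid_scheme \<Rightarrow> bool" where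
  "p_primary p G \<longleftrightarrow> (\<forall>x \<in> carrier G. \<exists>k::nat. x [^]\<^bsub>G\<^esub> (p ^ k) = \<one>\<^bsub>G\<^esub>)"

definition multiples :: "nat \<Rightarrow> ('a, 'm) monoid_scheme \<Rightarrow> 'a set" where
  "multiples n G = (\<lambda>x. x [^]\<^bsub>G\<^esub> n) ` carrier G"

definition p_omega :: "nat \<Rightarrow> ('a, 'm) monoid_scheme \<Rightarrow> 'a set" where
  "p_omega p G = (\<Inter>n::nat. multiples (p ^ n) G)"

definition bounded_group :: "('a, 'm) monoid_scheme \<Rightarrow> bool" where
  "bounded_group G \<longleftrightarrow> (\<exists>m::nat. m > 0 \<and> (\<forall>x \<in> carrier G. x [^]\<^bsub>G\<^esub> m = \<one>\<^bsub>G\<^esub>))"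

end

theory Submission
  imports Defs
begin

text \<open>
  Write \<open>N\<close> for the subgroup \<open>p_omega p G\<close>, and let \<open>f\<close> map \<open>G\<close> onto \<open>G \<times>\<times> A\<close>. The first
  component \<open>g = fst \<circ> f\<close> is a surjective endomorphism of \<open>G\<close>. Homomorphisms do not decrease
  heights (\<open>hom_p_omega\<close>), so \<open>g\<close> maps \<open>N\<close> into itself and induces a surjective endomorphism of
  \<open>G Mod N\<close>. Since \<open>G Mod N\<close> is Hopfian, that endomorphism is injective, which means that an
  element with \<open>g\<close>-image in \<open>N\<close> already lies in \<open>N\<close> (\<open>hopfian_quotient_preimage\<close>).

  Every \<open>a\<close> in \<open>A\<close> is the second component of \<open>f x\<close> for some \<open>x\<close> with \<open>g x = \<one>\<close>, and such an \<open>x\<close>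
  lies in \<open>N\<close>. Hence \<open>A\<close> is a homomorphic image of a subgroup of \<open>N\<close>. It follows that \<open>A\<close>
  inherits the bound of \<open>N\<close>, and also that every \<open>a\<close> is infinitely \<open>p\<close>-divisible in \<open>A\<close>. As \<open>A\<close> is
  \<open>p\<close>-primary too, its bound can be taken to be a power of \<open>p\<close> (\<open>p_primary_bounded\<close>). A group
  that is \<open>p\<close>-divisible and annihilated by a power of \<open>p\<close> is trivial.
\<close>

lemma subgroup_p_omega:
  assumes "comm_group G"
  shows "subgroup (p_omega p G) G"
proof -
  interpret comm_group G by fact
  have "subgroup (multiples n G) G" for n
  proof -
    have "(\<lambda>x. x [^]\<^bsub>G\<^esub> n) \<in> hom G G"
      by (auto simp: hom_def nat_pow_distrib)
    then interpret power: group_hom G G "\<lambda>x. x [^]\<^bsub>G\<^esub> n"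
      by unfold_locales
    show ?thesis
      unfolding multiples_def by (rule power.img_is_subgroup)
  qed
  then show ?thesis
    unfolding p_omega_def by (intro subgroups_Inter) auto
qed

lemma hom_p_omega:
  assumes "h \<in> hom G H" "group G" "group H" "x \<in> p_omega p G"
  shows "h x \<in> p_omega p H"
  unfolding p_omega_def multiples_def
proof
  fix n
  from assms(4) obtain y where y: "y \<in> carrier G" "x = y [^]\<^bsub>G\<^esub> (p ^ n)"
    unfolding p_omega_def multiples_def by blast
  have "h x = h y [^]\<^bsub>H\<^esub> (p ^ n)"
    using hom_nat_pow[OF assms(1) y(1) assms(2,3)] y(2) by simp
  then show "h x \<in> (\<lambda>z. z [^]\<^bsub>H\<^esub> (p ^ n)) ` carrier H"
    using hom_in_carrier[OF assms(1) y(1)] by (rule image_eqI)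
qed

text \<open>
  The endomorphism of the quotient induced by \<open>g\<close> is surjective, hence injective by Hopficity,
  so \<open>g\<close> cannot carry a coset other than \<open>N\<close> into \<open>N\<close>.
\<close>

lemma hopfian_quotient_preimage:
  assumes "N \<lhd> G" "hopfian (G Mod N)"
    and g: "g \<in> epi G G" "g ` N \<subseteq> N"
    and x: "x \<in> carrier G" "g x \<in> N"
  shows "x \<in> N"
proof -
  interpret normal N G by fact
  let ?q = "r_coset G N"
  have subgr: "subgroup N G"
    by unfold_locales
  have g_hom: "g \<in> hom G G" and g_surj: "g ` carrier G = carrier G"
    using g(1) by (auto simp: epi_def)
  interpret composite: group_hom G "G Mod N" "?q \<circ> g"
    using Group.hom_compose[OF g_hom r_coset_hom_Mod] factorgroup_is_group is_group
    by (simp add: group_hom_def group_hom_axioms_def)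
  have "N \<subseteq> kernel G (G Mod N) (?q \<circ> g)"
    using g(2) subset coset_join2[OF _ subgr] by (auto simp: kernel_def)
  then obtain h where h: "h \<in> hom (G Mod N) (G Mod N)"
      "\<And>y. y \<in> carrier G \<Longrightarrow> h (?q y) = ?q (g y)"
    using composite.FactGroup_universal_kernel[OF \<open>N \<lhd> G\<close>] by auto
  have "h ` carrier (G Mod N) = ?q ` g ` carrier G"
    using h(2) by (auto simp: carrier_FactGroup image_image)
  then have "h \<in> epi (G Mod N) (G Mod N)"
    using h(1) by (simp add: epi_def g_surj carrier_FactGroup)
  then have inj: "inj_on h (carrier (G Mod N))"
    using \<open>hopfian (G Mod N)\<close> by (simp add: hopfian_def)
  have "h (?q x) = N"
    using h(2)[OF x(1)] coset_join2[OF _ subgr x(2)] subset x(2) by auto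
  also have "N = h N"
    using hom_one[OF h(1) factorgroup_is_group factorgroup_is_group] by simp
  finally have "?q x = N"
    using inj x(1) group.is_monoid[OF factorgroup_is_group, THEN monoid.one_closed]
    by (simp add: inj_on_eq_iff carrier_FactGroup)
  then show ?thesis
    using coset_join1[OF _ x(1) subgr] by simp
qed

text \<open>
  The order of \<open>x\<close> is a power \<open>p ^ i\<close> dividing \<open>m\<close>, and \<open>i < p ^ i \<le> m\<close>. The exponent \<open>m\<close> is
  therefore larger than needed, but it does not depend on \<open>x\<close>.
\<close>

lemma p_primary_bounded:
  assumes "group G" "Factorial_Ring.prime (p::nat)" "m > 0" "x \<in> carrier G"
    and "x [^]\<^bsub>G\<^esub> m = \<one>\<^bsub>G\<^esub>" "x [^]\<^bsub>G\<^esub> (p ^ k) = \<one>\<^bsub>G\<^esub>"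
  shows "x [^]\<^bsub>G\<^esub> (p ^ m) = \<one>\<^bsub>G\<^esub>"
proof -
  interpret group G by fact
  have "ord x dvd m" "ord x dvd p ^ k"
    using assms pow_eq_id by auto
  then obtain i where i: "ord x = p ^ i"
    using divides_primepow_nat[OF \<open>Factorial_Ring.prime p\<close>] by blast
  have "i < p ^ i"
    using prime_gt_1_nat[OF \<open>Factorial_Ring.prime p\<close>] by (simp add: power_gt_expt)
  also have "p ^ i \<le> m"
    using \<open>ord x dvd m\<close> \<open>m > 0\<close> i by (auto dest: dvd_imp_le)
  finally have "ord x dvd p ^ m"
    using i by (simp add: le_imp_power_dvd)
  then show ?thesis
    using assms pow_eq_id by blast
qed

theorem proposition3p4:
  fixes G :: "('a, 'm) monoid_scheme" and p :: nat
  assumes "Factorial_Ring.prime p"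
    and "comm_group G"
    and "p_primary p G"
    and "bounded_group (G\<lparr>carrier := p_omega p G\<rparr>)"
    and "hopfian (G Mod p_omega p G)"
  shows "relatively_hopfian TYPE('b) G"
  unfolding relatively_hopfian_def
proof (intro allI impI)
  fix A :: "'b monoid"
  assume "comm_group A" and "epi G (G \<times>\<times> A) \<noteq> {}"
  then obtain f where f: "f \<in> hom G (G \<times>\<times> A)" "f ` carrier G = carrier G \<times> carrier A"
    by (auto simp: epi_def)
  interpret G: comm_group G by fact
  interpret A: comm_group A by fact
  let ?N = "p_omega p G" and ?g = "fst \<circ> f" and ?s = "snd \<circ> f"
  have g: "?g \<in> hom G G" and s: "?s \<in> hom G A"
    using f(1) by (simp_all add: hom_pairwise)
  have s_pow: "?s (x [^]\<^bsub>G\<^esub> n) = ?s x [^]\<^bsub>A\<^esub> n" if "x \<in> carrier G" for x and n :: nat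
    using hom_nat_pow[OF s that] by simp
  have "?g ` carrier G = fst ` (carrier G \<times> carrier A)"
    using f(2) by (metis image_comp)
  then have g_epi: "?g \<in> epi G G"
    using g A.one_closed by (auto simp: epi_def)
  have N: "?N \<lhd> G"
    using subgroup_p_omega[OF \<open>comm_group G\<close>] by (rule G.subgroup_imp_normal)
  obtain m :: nat where "m > 0" and m: "\<And>x. x \<in> ?N \<Longrightarrow> x [^]\<^bsub>G\<^esub> m = \<one>\<^bsub>G\<^esub>"
    using assms(4) by (auto simp: bounded_group_def nat_pow_def)
  have lift: "\<exists>x \<in> ?N. x \<in> carrier G \<and> ?s x = a" if "a \<in> carrier A" for a
  proof -
    have "(\<one>\<^bsub>G\<^esub>, a) \<in> f ` carrier G"
      using f(2) that by simp
    then obtain x where x: "x \<in> carrier G" "f x = (\<one>\<^bsub>G\<^esub>, a)"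
      by (metis imageE)
    have "x \<in> ?N"
    proof (rule hopfian_quotient_preimage[OF N assms(5) g_epi _ x(1)])
      show "?g ` ?N \<subseteq> ?N"
        using hom_p_omega[OF g] by auto
      show "?g x \<in> ?N"
        using x(2) subgroup.one_closed[OF normal_imp_subgroup[OF N]] by simp
    qed
    with x show ?thesis by auto
  qed
  have annihilated: "a [^]\<^bsub>A\<^esub> (p ^ m) = \<one>\<^bsub>A\<^esub>" if a: "a \<in> carrier A" for a
  proof -
    obtain x where x: "x \<in> ?N" "x \<in> carrier G" "?s x = a"
      using lift[OF a] by blast
    obtain k where k: "x [^]\<^bsub>G\<^esub> (p ^ k) = \<one>\<^bsub>G\<^esub>"
      using \<open>p_primary p G\<close> x(2) by (auto simp: p_primary_def)
    have "a [^]\<^bsub>A\<^esub> m = \<one>\<^bsub>A\<^esub>" "a [^]\<^bsub>A\<^esub> (p ^ k) = \<one>\<^bsub>A\<^esub>"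
      using s_pow[OF x(2), of m] s_pow[OF x(2), of "p ^ k"] m[OF x(1)] k x(3)
        hom_one[OF s G.is_group A.is_group] by simp_all
    then show ?thesis
      using p_primary_bounded[OF A.is_group assms(1) \<open>m > 0\<close> a] by blast
  qed
  have "a = \<one>\<^bsub>A\<^esub>" if a: "a \<in> carrier A" for a
  proof -
    obtain x where x: "x \<in> ?N" "?s x = a"
      using lift[OF a] by blast
    \<comment> \<open>Divide by exactly the power of \<open>p\<close> that annihilates \<open>A\<close>.\<close>
    have "a \<in> multiples (p ^ m) A"
      using hom_p_omega[OF s G.is_group A.is_group x(1)] x(2) by (auto simp: p_omega_def)
    then obtain b where "b \<in> carrier A" "a = b [^]\<^bsub>A\<^esub> (p ^ m)"
      by (auto simp: multiples_def)
    then show ?thesis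
      using annihilated by simp
  qed
  then show "trivial_group A"
    by (auto simp: A.trivial_group_subset)
qed

end
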